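(* Let $(\Omega,\Sigma,\mu)$ be a $\sigma$-finite measure space, $\mathcal{A}\subseteq\Sigma$ a $\sigma$-subalgebra such that $(\Omega,\mathcal{A},\mu)$ is $\sigma$-finite, $E=E^{\mathcal{A}}$ the conditional expectation, $1<q<p<\infty$, $\frac1p+\frac1{p'}=1$, $u$ a $\Sigma$-measurable function on $\Omega$, and let $R_u:\mathcal{D}\subseteq L^{p}(\Sigma)\to L^{q}(\Sigma)$, $R_u(f)=E(uf)$, be well defined. Then $R_u$ is bounded from $L^{p}(\Sigma)$ into $L^{q}(\Sigma)$ if and only if $(E(|u|^{p'}))^{\frac1{p'}}\in L^{r}(\mathcal{A})$, where $r=\frac{pq}{p-q}$. In particular, if $\mathcal{A}=\Sigma$ (so that $E=I$), the multiplication operator $M_u:f\mapsto uf$ is bounded from $L^{p}(\Sigma)$ into $L^{q}(\Sigma)$ if and only if $u\in L^{r}(\Sigma)$.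
   Context: $E(f)=E^{\mathcal{A}}(f)$ is the a.e. unique $\mathcal{A}$-measurable function with $\int_A f\,d\mu=\int_A E(f)\,d\mu$ for $A\in\mathcal{A}$, defined for nonnegative measurable $f$ and extended by linearity to $f$ with $E(|f|)<\infty$ a.e.; $f$ is conditionable if $E(f)$ is defined. The operator $R_u:\mathcal{D}\to L^{q}(\Sigma)$, $R_u(f)=E(uf)$, is well defined on the linear subspace $\mathcal{D}\subseteq L^p(\Sigma)$ if for all $f\in\mathcal{D}$, $uf$ is conditionable and $E(uf)\in L^{q}(\Sigma)$. "Bounded from $L^p(\Sigma)$ into $L^q(\Sigma)$" means well defined on all of $L^p(\Sigma)$ with $\|R_uf\|_q\le K\|f\|_p$ for some constant $K$ and all $f\in L^p(\Sigma)$. $L^r(\mathcal{A})$ denotes the $\mathcal{A}$-measurable functions in $L^r$. *)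

theory Defs
  imports "HOL-Probability.Probability"
begin

text \<open>
  Functions take values in a scalar field \<open>'k\<close> that is a normed field and a Euclidean space; the
  instances are the real and the complex numbers. Elements of \<open>L\<^sup>p\<close> are represented by
  functions, not by classes modulo almost everywhere equality.
\<close>

definition Lp :: "'a measure \<Rightarrow> real \<Rightarrow> ('a \<Rightarrow> 'k::{real_normed_field, euclidean_space}) set" where
  "Lp M p = {f \<in> borel_measurable M. integrable M (\<lambda>x. norm (f x) powr p)}"

definition Lp_norm ::
  "'a measure \<Rightarrow> real \<Rightarrow> ('a \<Rightarrow> 'k::{real_normed_field, euclidean_space}) \<Rightarrow> real" where
  "Lp_norm M p f = (\<integral>x. norm (f x) powr p \<partial>M) powr (1 / p)"

text \<open>The power \<open>t\<^sup>a\<close> of an extended nonnegative number, for \<open>a > 0\<close>.\<close>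

definition ennreal_powr :: "ennreal \<Rightarrow> real \<Rightarrow> ennreal" where
  "ennreal_powr t a = (if t = \<infinity> then \<infinity> else ennreal (enn2real t powr a))"

text \<open>
  Membership in \<open>L\<^sup>p\<close> for functions with values in \<open>[0, \<infinity>]\<close>, such as conditional expectations of
  nonnegative functions. Since \<open>enn2real \<infinity> = 0\<close>, finiteness almost everywhere has to be required
  separately.
\<close>

definition ennreal_Lp :: "'a measure \<Rightarrow> real \<Rightarrow> ('a \<Rightarrow> ennreal) set" where
  "ennreal_Lp M p = {g \<in> borel_measurable M.
     (AE x in M. g x < \<infinity>) \<and> (\<lambda>x. enn2real (g x)) \<in> Lp M p}"

definition conditionable ::
  "'a measure \<Rightarrow> 'a measure \<Rightarrow> ('a \<Rightarrow> 'k::{real_normed_field, euclidean_space}) \<Rightarrow> bool" where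
  "conditionable M F f \<longleftrightarrow> f \<in> borel_measurable M \<and>
     (AE x in M. nn_cond_exp M F (\<lambda>y. ennreal (norm (f y))) x < \<infinity>)"

text \<open>
  The library's \<^const>\<open>real_cond_exp\<close> is the difference of the \<^const>\<open>nn_cond_exp\<close> of the positive and
  negative parts, hence already the extension by linearity to conditionable real functions. Scalar
  functions are treated by components; see the two lemmas below for real and complex scalars.
\<close>

definition cond_expect ::
  "'a measure \<Rightarrow> 'a measure \<Rightarrow> ('a \<Rightarrow> 'k::{real_normed_field, euclidean_space}) \<Rightarrow> 'a \<Rightarrow> 'k" where
  "cond_expect M F f x = (\<Sum>b\<in>Basis. real_cond_exp M F (\<lambda>y. f y \<bullet> b) x *\<^sub>R b)"

lemma cond_expect_real: "cond_expect M F (f :: 'a \<Rightarrow> real) = real_cond_exp M F f"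
  by (simp add: cond_expect_def fun_eq_iff)

lemma cond_expect_complex:
  "cond_expect M F (f :: 'a \<Rightarrow> complex) x =
     Complex (real_cond_exp M F (\<lambda>y. Re (f y)) x) (real_cond_exp M F (\<lambda>y. Im (f y)) x)"
  by (simp add: cond_expect_def Basis_complex_def complex_eq_iff inner_complex_def)

definition cond_op :: "'a measure \<Rightarrow> 'a measure \<Rightarrow>
    ('a \<Rightarrow> 'k::{real_normed_field, euclidean_space}) \<Rightarrow> ('a \<Rightarrow> 'k) \<Rightarrow> 'a \<Rightarrow> 'k" where
  "cond_op M F u f = cond_expect M F (\<lambda>x. u x * f x)"

definition linear_subspace_Lp ::
  "'a measure \<Rightarrow> real \<Rightarrow> ('a \<Rightarrow> 'k::{real_normed_field, euclidean_space}) set \<Rightarrow> bool" where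
  "linear_subspace_Lp M p D \<longleftrightarrow> D \<subseteq> Lp M p \<and> (\<lambda>x. 0) \<in> D \<and>
     (\<forall>f\<in>D. \<forall>g\<in>D. (\<lambda>x. f x + g x) \<in> D) \<and> (\<forall>c. \<forall>f\<in>D. (\<lambda>x. c * f x) \<in> D)"

definition cond_op_well_defined :: "'a measure \<Rightarrow> 'a measure \<Rightarrow>
    ('a \<Rightarrow> 'k::{real_normed_field, euclidean_space}) \<Rightarrow> real \<Rightarrow> ('a \<Rightarrow> 'k) set \<Rightarrow> bool" where
  "cond_op_well_defined M F u q D \<longleftrightarrow>
     (\<forall>f\<in>D. conditionable M F (\<lambda>x. u x * f x) \<and> cond_op M F u f \<in> Lp M q)"

definition norm_bounded :: "'a measure \<Rightarrow> real \<Rightarrow> real \<Rightarrow>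
    (('a \<Rightarrow> 'k::{real_normed_field, euclidean_space}) \<Rightarrow> 'a \<Rightarrow> 'k) \<Rightarrow> bool" where
  "norm_bounded M p q T \<longleftrightarrow> (\<exists>K. \<forall>f\<in>Lp M p. Lp_norm M q (T f) \<le> K * Lp_norm M p f)"

definition cond_op_bounded :: "'a measure \<Rightarrow> 'a measure \<Rightarrow>
    ('a \<Rightarrow> 'k::{real_normed_field, euclidean_space}) \<Rightarrow> real \<Rightarrow> real \<Rightarrow> bool" where
  "cond_op_bounded M F u p q \<longleftrightarrow>
     cond_op_well_defined M F u q (Lp M p) \<and> norm_bounded M p q (cond_op M F u)"

definition mult_op :: "('a \<Rightarrow> 'k::{real_normed_field, euclidean_space}) \<Rightarrow> ('a \<Rightarrow> 'k) \<Rightarrow> 'a \<Rightarrow> 'k" where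
  "mult_op u f = (\<lambda>x. u x * f x)"

definition mult_op_bounded :: "'a measure \<Rightarrow>
    ('a \<Rightarrow> 'k::{real_normed_field, euclidean_space}) \<Rightarrow> real \<Rightarrow> real \<Rightarrow> bool" where
  "mult_op_bounded M u p q \<longleftrightarrow>
     (\<forall>f\<in>Lp M p. mult_op u f \<in> Lp M q) \<and> norm_bounded M p q (mult_op u)"

end

theory Submission
  imports Defs
begin

text \<open>
  Write \<open>w = E(|u|\<^sup>p\<^sup>')\<close>. If \<open>w\<close> to the power \<open>1/p'\<close> is in \<open>L\<^sup>r\<close>, boundedness follows from the conditional
  Hoelder inequality, followed by Young's inequality. Conversely, cut \<open>|u|\<^sup>p\<^sup>'\<close> off to a bounded
  function \<open>\<phi>\<close> supported in a set of finite measure, put \<open>v = E(\<phi>)\<close>, and test the operator on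
  \<open>f = k \<phi> / u\<close>, where \<open>k\<close> is the power of \<open>v\<close> with exponent \<open>(q - 1)/(p - q)\<close>. This exponent makes
  \<open>|E(uf)|\<^sup>q\<close> and \<open>E(|f|\<^sup>p)\<close> both equal to the power \<open>r/p'\<close> of \<open>v\<close>, so the norm inequality bounds the
  integral of that power independently of the cut-off; let the cut-off tend to infinity.
\<close>

section \<open>Powers of extended nonnegative numbers\<close>

lemma ennreal_powr_measurable [measurable]:
  assumes [measurable]: "g \<in> borel_measurable M"
  shows "(\<lambda>x. ennreal_powr (g x) a) \<in> borel_measurable M"
  unfolding ennreal_powr_def by measurable

lemma enn2real_ennreal_powr: "enn2real (ennreal_powr t a) = enn2real t powr a"
  by (simp add: ennreal_powr_def)

lemma ennreal_powr_less_top_iff: "ennreal_powr t a < top \<longleftrightarrow> t < top"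
  by (auto simp: ennreal_powr_def top.not_eq_extremum)

section \<open>Two consequences of Young's inequality for real numbers\<close>

text \<open>With this \<open>t\<close>, both \<open>t powr p' * (a + e)\<close> and
  \<open>t powr (- p) * (b + e)\<close> equal the right-hand side, so their average with weights
  \<open>1 / p'\<close> and \<open>1 / p\<close> is again that product. This turns an additive Young
  bound into a multiplicative Hoelder bound.\<close>

lemma Young_balanced_weight:
  fixes a b e p p' t :: real
  assumes "a \<ge> 0" "b \<ge> 0" "e > 0" "p > 1" "p' > 1" "1 / p + 1 / p' = 1"
    and t: "t = ((b + e) / (a + e)) powr (1 / (p * p'))"
  shows "t powr p' / p' * a + t powr (- p) / p * b \<le> (a + e) powr (1 / p') * (b + e) powr (1 / p)"
proof -
  let ?A = "a + e" and ?B = "b + e"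
  let ?X = "?A powr (1 / p') * ?B powr (1 / p)"
  have pos: "?A > 0" "?B > 0" using assms by auto
  have e1: "1 - 1 / p = 1 / p'" and e2: "1 - 1 / p' = 1 / p" using assms by auto
  have "t powr p' * ?A = ?A powr (1 - 1 / p) * ?B powr (1 / p)"
    using pos assms by (simp add: t powr_powr powr_divide powr_diff)
  then have t1: "t powr p' * ?A = ?X" unfolding e1 .
  have "t powr (- p) = ((b + e) / (a + e)) powr (- (1 / p'))"
    using assms(4,5) unfolding t powr_powr by simp
  also have "\<dots> = ?A powr (1 / p') * ?B powr (- (1 / p'))"
    using pos by (simp add: powr_divide powr_minus divide_simps)
  finally have "t powr (- p) * ?B = ?A powr (1 / p') * ?B powr (1 - 1 / p')"
    using pos powr_add[of ?B "- (1 / p')" 1] by (simp add: algebra_simps)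
  then have t2: "t powr (- p) * ?B = ?X" unfolding e2 .
  have "t powr p' / p' * a \<le> t powr p' / p' * ?A"
    using assms by (intro mult_left_mono) auto
  also have "\<dots> = ?X / p'" using t1 by (simp add: field_simps)
  finally have 1: "t powr p' / p' * a \<le> ?X / p'" .
  have "t powr (- p) / p * b \<le> t powr (- p) / p * ?B"
    using assms by (intro mult_left_mono) auto
  also have "\<dots> = ?X / p" using t2 by (simp add: field_simps)
  finally have 2: "t powr (- p) / p * b \<le> ?X / p" .
  have "?X / p' + ?X / p = ?X * (1 / p + 1 / p')" by (simp add: algebra_simps)
  with 1 2 assms(6) show ?thesis by simp
qed

lemma conjugate_exponent_gt_1:
  fixes p p' :: real
  assumes "1 < p" "1 / p + 1 / p' = 1"
  shows "1 < p'"
proof -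
  have "p' \<noteq> 0" using assms by auto
  then have "p' = p / (p - 1)" using assms by (simp add: field_simps)
  then show ?thesis using assms by simp
qed

text \<open>Young's inequality with the conjugate exponents \<open>p / (p - q)\<close> and
  \<open>p / q\<close>, applied to \<open>a powr (q / p')\<close> and
  \<open>(G / N) powr (q / p)\<close>. In the application \<open>G\<close> is E(|f|^p) at a point
  and \<open>N\<close> is its integral, so \<open>G / N\<close> integrates to 1 and the integrated
  bound scales like the norm of f to the power \<open>q\<close>.\<close>

lemma Young_scaled:
  fixes a G N q p r p' :: real
  assumes "1 < q" "q < p" "1 / p + 1 / p' = 1" "r = p * q / (p - q)" "a \<ge> 0" "G \<ge> 0" "N > 0"
  shows "(a powr (1 / p') * G powr (1 / p)) powr q \<le> N powr (q / p) * (a powr (r / p') + G / N)"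
proof -
  have p': "p' > 1" using conjugate_exponent_gt_1[of p p'] assms by simp
  let ?s = "p / (p - q)" and ?s' = "p / q"
  have "a powr (q / p') * (G / N) powr (q / p)
      \<le> (a powr (q / p')) powr ?s / ?s + ((G / N) powr (q / p)) powr ?s' / ?s'"
    using assms by (intro Youngs_inequality) (auto simp: field_simps)
  also have "(a powr (q / p')) powr ?s = a powr (r / p')"
    using assms by (simp add: powr_powr mult.commute)
  also have "((G / N) powr (q / p)) powr ?s' = G / N"
    using assms by (simp add: powr_powr)
  also have "a powr (r / p') / ?s + G / N / ?s' \<le> a powr (r / p') + G / N"
  proof (rule add_mono)
    have le: "x / s \<le> x" if "x \<ge> 0" "1 \<le> s" for x s :: real
      using divide_left_mono[of 1 s x] that by simp
    show "a powr (r / p') / ?s \<le> a powr (r / p')"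
      by (rule le) (use assms in auto)
    show "G / N / ?s' \<le> G / N"
      by (rule le) (use assms in auto)
  qed
  finally have *: "a powr (q / p') * (G / N) powr (q / p) \<le> a powr (r / p') + G / N" .
  have "(a powr (1 / p') * G powr (1 / p)) powr q = N powr (q / p) * (a powr (q / p') * (G / N) powr (q / p))"
    using assms by (simp add: powr_mult powr_powr powr_divide)
  with * show ?thesis by (simp add: mult_left_mono)
qed

section \<open>Conditional expectations: monotone convergence and Hoelder's inequality\<close>

lemma borel_measurable_cond_expect [measurable]:
  "cond_expect M F f \<in> borel_measurable M"
  unfolding cond_expect_def[abs_def] by measurable

lemma cond_expect_of_real:
  "cond_expect M F (\<lambda>x. of_real (g x) :: 'k::{real_normed_field, euclidean_space}) x
     = (\<Sum>b\<in>Basis. real_cond_exp M F (\<lambda>x. g x * (1 \<bullet> b)) x *\<^sub>R b)"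
  by (simp add: cond_expect_def of_real_def)

context sigma_finite_subalgebra
begin

text \<open>Conditional monotone convergence. On each set of \<open>F\<close>, ordinary monotone
  convergence is applied once to \<open>f n\<close> and once to its conditional expectation;
  uniqueness of the conditional expectation does the rest.\<close>

lemma nn_cond_exp_SUP:
  fixes f :: "nat \<Rightarrow> 'a \<Rightarrow> ennreal"
  assumes meas [measurable]: "\<And>n. f n \<in> borel_measurable M"
    and inc: "\<And>x. incseq (\<lambda>n. f n x)"
  shows "AE x in M. incseq (\<lambda>n. nn_cond_exp M F (f n) x)"
    and "AE x in M. nn_cond_exp M F (\<lambda>x. SUP n. f n x) x = (SUP n. nn_cond_exp M F (f n) x)"
proof -
  have "AE x in M. nn_cond_exp M F (f n) x \<le> nn_cond_exp M F (f (Suc n)) x" for n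
    by (rule nn_cond_exp_mono) (use inc in \<open>auto simp: incseq_Suc_iff\<close>)
  then have "AE x in M. \<forall>n. nn_cond_exp M F (f n) x \<le> nn_cond_exp M F (f (Suc n)) x"
    by (simp add: AE_all_countable)
  then show mono: "AE x in M. incseq (\<lambda>n. nn_cond_exp M F (f n) x)"
    by (simp add: incseq_Suc_iff)
  have "AE x in M. (SUP n. nn_cond_exp M F (f n) x) = nn_cond_exp M F (\<lambda>x. SUP n. f n x) x"
  proof (rule nn_cond_exp_charact)
    fix A assume [measurable]: "A \<in> sets F"
    have [measurable]: "A \<in> sets M" using subalg by (auto simp: subalgebra_def)
    have "(\<integral>\<^sup>+ x \<in> A. (SUP n. f n x) \<partial>M) = (\<integral>\<^sup>+ x. (SUP n. indicator A x * f n x) \<partial>M)"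
      by (simp add: SUP_mult_left_ennreal mult.commute)
    also have "\<dots> = (SUP n. \<integral>\<^sup>+ x. indicator A x * f n x \<partial>M)"
      by (rule nn_integral_monotone_convergence_SUP)
         (use inc in \<open>auto simp: incseq_def le_fun_def intro!: mult_left_mono\<close>)
    also have "\<dots> = (SUP n. \<integral>\<^sup>+ x. indicator A x * nn_cond_exp M F (f n) x \<partial>M)"
      by (simp add: nn_cond_exp_intg)
    also have "\<dots> = (\<integral>\<^sup>+ x. (SUP n. indicator A x * nn_cond_exp M F (f n) x) \<partial>M)"
      by (rule nn_integral_monotone_convergence_SUP_AE[symmetric])
         (use mono in \<open>auto simp: incseq_Suc_iff intro!: mult_left_mono\<close>)
    also have "\<dots> = (\<integral>\<^sup>+ x \<in> A. (SUP n. nn_cond_exp M F (f n) x) \<partial>M)"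
      by (simp add: SUP_mult_left_ennreal mult.commute)
    finally show "(\<integral>\<^sup>+ x \<in> A. (SUP n. f n x) \<partial>M) = (\<integral>\<^sup>+ x \<in> A. (SUP n. nn_cond_exp M F (f n) x) \<partial>M)" .
  qed measurable
  then show "AE x in M. nn_cond_exp M F (\<lambda>x. SUP n. f n x) x = (SUP n. nn_cond_exp M F (f n) x)"
    by eventually_elim simp
qed

lemma nn_cond_exp_less_top:
  assumes [measurable]: "f \<in> borel_measurable M" and "(\<integral>\<^sup>+ x. f x \<partial>M) < \<infinity>"
  shows "AE x in M. nn_cond_exp M F f x < \<infinity>"
proof -
  have "(\<integral>\<^sup>+ x. nn_cond_exp M F f x \<partial>M) = (\<integral>\<^sup>+ x. f x \<partial>M)"
    using nn_cond_exp_intg[of "\<lambda>_. 1" f] by simp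
  then have "AE x in M. nn_cond_exp M F f x \<noteq> \<infinity>"
    using assms by (intro nn_integral_PInf_AE) auto
  then show ?thesis by (simp add: top.not_eq_extremum)
qed

text \<open>Integrability makes the conditional expectation finite almost everywhere, so the
  \<open>enn2real\<close> inside \<open>real_cond_exp\<close> loses nothing; the negative part
  contributes zero.\<close>

lemma ennreal_real_cond_exp:
  assumes "integrable M f" and "\<And>x. f x \<ge> 0"
  shows "AE x in M. ennreal (real_cond_exp M F f x) = nn_cond_exp M F (\<lambda>x. ennreal (f x)) x"
proof -
  have [measurable]: "f \<in> borel_measurable M" using assms by simp
  have "AE x in M. 0 = nn_cond_exp M F (\<lambda>_. 0) x"
    by (rule nn_cond_exp_F_meas) simp
  moreover have "(\<lambda>x. ennreal (- f x)) = (\<lambda>_. 0)"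
    using assms(2) by (auto simp: ennreal_neg)
  moreover have "AE x in M. nn_cond_exp M F (\<lambda>x. ennreal (f x)) x < \<infinity>"
    using assms by (intro nn_cond_exp_less_top) (auto simp: nn_integral_eq_integral)
  ultimately show ?thesis
    by (auto simp: real_cond_exp_def elim!: eventually_elim2)
qed

text \<open>Young's inequality is applied to \<open>(t * f) * (g / t)\<close> with a positive weight
  \<open>t\<close>. If \<open>t\<close> is measurable with respect to \<open>F\<close>, its powers
  leave the conditional expectation, so \<open>t\<close> may be chosen pointwise in terms of
  \<open>w\<close> and \<open>G\<close>.\<close>

lemma nn_cond_exp_Hoelder:
  fixes f g :: "'a \<Rightarrow> real" and p p' :: real
  defines "w \<equiv> nn_cond_exp M F (\<lambda>x. ennreal (f x powr p'))"
    and "G \<equiv> nn_cond_exp M F (\<lambda>x. ennreal (g x powr p))"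
  assumes [measurable]: "f \<in> borel_measurable M" "g \<in> borel_measurable M"
    and nonneg: "\<And>x. f x \<ge> 0" "\<And>x. g x \<ge> 0"
    and pq: "p > 1" "p' > 1" "1 / p + 1 / p' = 1"
    and fin: "AE x in M. w x < \<infinity>" "AE x in M. G x < \<infinity>"
  shows "AE x in M. nn_cond_exp M F (\<lambda>x. ennreal (f x * g x)) x
           \<le> ennreal (enn2real (w x) powr (1 / p') * enn2real (G x) powr (1 / p))"
proof -
  have [measurable]: "w \<in> borel_measurable F" "G \<in> borel_measurable F"
    by (auto simp: w_def G_def)
  \<comment> \<open>The weight \<open>t\<close> would balance the two terms of Young's inequality exactly for \<open>e = 0\<close>; a
    positive \<open>e\<close> keeps it well defined where \<open>w\<close> or \<open>G\<close> vanishes.\<close>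
  have approx: "AE x in M. nn_cond_exp M F (\<lambda>x. ennreal (f x * g x)) x
      \<le> ennreal ((enn2real (w x) + e) powr (1 / p') * (enn2real (G x) + e) powr (1 / p))"
    if "e > 0" for e
  proof -
    define t where "t x = ((enn2real (G x) + e) / (enn2real (w x) + e)) powr (1 / (p * p'))" for x
    have [measurable]: "t \<in> borel_measurable F" unfolding t_def by measurable
    then have [measurable]: "t \<in> borel_measurable M" by (rule measurable_from_subalg[OF subalg])
    have tpos: "t x > 0" for x
    proof -
      have "enn2real (G x) + e > 0" "enn2real (w x) + e > 0"
        using \<open>e > 0\<close> by (simp_all add: add_nonneg_pos)
      then show ?thesis unfolding t_def by simp
    qed
    let ?a = "\<lambda>x. ennreal (t x powr p' / p')" and ?b = "\<lambda>x. ennreal (t x powr (- p) / p)"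
    have [measurable]: "?a \<in> borel_measurable F" "?b \<in> borel_measurable F" by measurable
    have [measurable]: "?a \<in> borel_measurable M" "?b \<in> borel_measurable M" by measurable
    have le: "ennreal (f x * g x) \<le> ?a x * ennreal (f x powr p') + ?b x * ennreal (g x powr p)" for x
    proof -
      have "f x * g x = (t x * f x) * (g x / t x)" using tpos[of x] by simp
      also have "\<dots> \<le> (t x * f x) powr p' / p' + (g x / t x) powr p / p"
        using tpos[of x] nonneg[of x] pq by (intro Youngs_inequality) auto
      also have "\<dots> = t x powr p' / p' * f x powr p' + t x powr (- p) / p * g x powr p"
        using tpos[of x] nonneg[of x] by (simp add: powr_mult powr_divide powr_minus field_simps)
      finally show ?thesis
        using pq by (simp add: ennreal_mult[symmetric] ennreal_plus[symmetric] del: ennreal_plus)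
    qed
    have "AE x in M. nn_cond_exp M F (\<lambda>x. ennreal (f x * g x)) x
        \<le> nn_cond_exp M F (\<lambda>x. ?a x * ennreal (f x powr p') + ?b x * ennreal (g x powr p)) x"
      by (rule nn_cond_exp_mono) (use le in auto)
    moreover have "AE x in M. nn_cond_exp M F (\<lambda>x. ?a x * ennreal (f x powr p')) x
          + nn_cond_exp M F (\<lambda>x. ?b x * ennreal (g x powr p)) x
        = nn_cond_exp M F (\<lambda>x. ?a x * ennreal (f x powr p') + ?b x * ennreal (g x powr p)) x"
      by (rule nn_cond_exp_sum) auto
    moreover have "AE x in M. ?a x * w x = nn_cond_exp M F (\<lambda>x. ?a x * ennreal (f x powr p')) x"
      unfolding w_def by (rule nn_cond_exp_prod) auto
    moreover have "AE x in M. ?b x * G x = nn_cond_exp M F (\<lambda>x. ?b x * ennreal (g x powr p)) x"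
      unfolding G_def by (rule nn_cond_exp_prod) auto
    ultimately show ?thesis using fin
    proof eventually_elim
      case (elim x)
      obtain a where a: "a \<ge> 0" "w x = ennreal a" using elim(5) by (cases "w x") auto
      obtain b where b: "b \<ge> 0" "G x = ennreal b" using elim(6) by (cases "G x") auto
      have "nn_cond_exp M F (\<lambda>x. ennreal (f x * g x)) x \<le> ?a x * w x + ?b x * G x"
        using elim by simp
      also have "\<dots> = ennreal (t x powr p' / p' * a + t x powr (- p) / p * b)"
        using a b pq by (simp add: ennreal_mult[symmetric] ennreal_plus[symmetric] del: ennreal_plus)
      also have "\<dots> \<le> ennreal ((a + e) powr (1 / p') * (b + e) powr (1 / p))"
        using a b \<open>e > 0\<close> pq by (intro ennreal_leI Young_balanced_weight) (auto simp: t_def)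
      finally show ?case using a b by simp
    qed
  qed
  \<comment> \<open>The exceptional null set depends on \<open>e\<close>, so \<open>e\<close> runs
    through a sequence tending to 0; the powers are continuous at 0 because their exponents are
    positive.\<close>
  have "AE x in M. \<forall>n. nn_cond_exp M F (\<lambda>x. ennreal (f x * g x)) x
      \<le> ennreal ((enn2real (w x) + inverse (real (Suc n))) powr (1 / p')
          * (enn2real (G x) + inverse (real (Suc n))) powr (1 / p))"
    unfolding AE_all_countable by (intro allI approx) simp
  then show ?thesis
  proof eventually_elim
    case (elim x)
    have lim: "(\<lambda>n. (c + inverse (real (Suc n))) powr s) \<longlonglongrightarrow> c powr s" if "c \<ge> 0" "s > 0" for c s :: real
    proof (rule tendsto_powr2)
      show "(\<lambda>n. c + inverse (real (Suc n))) \<longlonglongrightarrow> c"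
        using tendsto_add[OF tendsto_const LIMSEQ_inverse_real_of_nat, of c] by simp
    qed (use that in auto)
    show ?case
      by (rule LIMSEQ_le_const[OF tendsto_ennrealI[OF tendsto_mult[OF lim lim]]])
         (use elim pq in auto)
  qed
qed

section \<open>Sufficiency of the integrability condition\<close>

text \<open>Each component is dominated by E(|f|), and summing over the basis costs the factor
  \<open>DIM('k)\<close>. The crude constant is harmless, since only boundedness is at
  stake.\<close>

lemma norm_cond_expect_le:
  fixes f :: "'a \<Rightarrow> 'k::{real_normed_field, euclidean_space}"
  assumes "conditionable M F f"
  shows "AE x in M. norm (cond_expect M F f x)
           \<le> real DIM('k) * enn2real (nn_cond_exp M F (\<lambda>y. ennreal (norm (f y))) x)"
proof -
  let ?h = "nn_cond_exp M F (\<lambda>y. ennreal (norm (f y)))"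
  have [measurable]: "f \<in> borel_measurable M" and fin: "AE x in M. ?h x < \<infinity>"
    using assms by (auto simp: conditionable_def)
  have "AE x in M. ennreal \<bar>real_cond_exp M F (\<lambda>y. f y \<bullet> b) x\<bar> \<le> ?h x" if "b \<in> Basis" for b :: 'k
  proof -
    have "AE x in M. ennreal \<bar>real_cond_exp M F (\<lambda>y. f y \<bullet> b) x\<bar>
        \<le> nn_cond_exp M F (\<lambda>y. ennreal \<bar>f y \<bullet> b\<bar>) x"
      by (rule real_cond_exp_abs) measurable
    moreover have "AE x in M. nn_cond_exp M F (\<lambda>y. ennreal \<bar>f y \<bullet> b\<bar>) x \<le> ?h x"
      using that by (intro nn_cond_exp_mono) (auto intro!: ennreal_leI Basis_le_norm)
    ultimately show ?thesis by eventually_elim (rule order_trans)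
  qed
  then have "AE x in M. \<forall>b\<in>Basis. ennreal \<bar>real_cond_exp M F (\<lambda>y. f y \<bullet> (b::'k)) x\<bar> \<le> ?h x"
    by (simp add: AE_finite_all)
  with fin show ?thesis
  proof eventually_elim
    case (elim x)
    obtain a where a: "a \<ge> 0" "?h x = ennreal a" using elim(1) by (cases "?h x") auto
    have "norm (cond_expect M F f x) \<le> (\<Sum>b\<in>Basis. norm (real_cond_exp M F (\<lambda>y. f y \<bullet> (b::'k)) x *\<^sub>R b))"
      unfolding cond_expect_def by (rule norm_sum)
    also have "\<dots> \<le> (\<Sum>b\<in>(Basis::'k set). a)"
      using elim(2) a by (intro sum_mono) simp
    finally show ?case using a by simp
  qed
qed

text \<open>The conditional Hoelder inequality bounds |E(uf)| by a multiple of \<open>w\<close> to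
  the power \<open>1 / p'\<close> times E(|f|^p) to the power \<open>1 / p\<close>. Then
  \<open>Young_scaled\<close> separates the two factors, and integration leaves a constant that does
  not depend on \<open>f\<close>.\<close>

lemma cond_op_estimate:
  fixes u f :: "'a \<Rightarrow> 'k::{real_normed_field, euclidean_space}" and p p' q r :: real
  defines "w \<equiv> nn_cond_exp M F (\<lambda>y. ennreal (norm (u y) powr p'))"
  assumes exps: "1 < q" "q < p" "1 / p + 1 / p' = 1" "r = p * q / (p - q)"
    and [measurable]: "u \<in> borel_measurable M"
    and fin: "AE x in M. w x < \<infinity>"
    and int: "integrable M (\<lambda>x. enn2real (w x) powr (r / p'))"
    and f: "f \<in> Lp M p"
  shows "conditionable M F (\<lambda>x. u x * f x)"
    and "cond_op M F u f \<in> Lp M q"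
    and "Lp_norm M q (cond_op M F u f)
      \<le> real DIM('k) * ((\<integral>x. enn2real (w x) powr (r / p') \<partial>M) + 1) powr (1 / q) * Lp_norm M p f"
proof -
  have p': "p' > 1" using conjugate_exponent_gt_1[of p p'] exps by simp
  have [measurable]: "f \<in> borel_measurable M" and fint: "integrable M (\<lambda>x. norm (f x) powr p)"
    using f by (auto simp: Lp_def)
  have [measurable]: "w \<in> borel_measurable M" by (auto simp: w_def)
  define G where "G = nn_cond_exp M F (\<lambda>y. ennreal (norm (f y) powr p))"
  have [measurable]: "G \<in> borel_measurable M" by (auto simp: G_def)
  define N where "N = (\<integral>x. norm (f x) powr p \<partial>M)"
  define I where "I = (\<integral>x. enn2real (w x) powr (r / p') \<partial>M)"
  have nonneg: "N \<ge> 0" "I \<ge> 0" by (auto simp: N_def I_def)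
  have nnN: "(\<integral>\<^sup>+x. ennreal (norm (f x) powr p) \<partial>M) = ennreal N"
    unfolding N_def by (rule nn_integral_eq_integral[OF fint]) auto
  have finG: "AE x in M. G x < \<infinity>"
    unfolding G_def by (rule nn_cond_exp_less_top) (auto simp: nnN)
  have nnG: "(\<integral>\<^sup>+x. G x \<partial>M) = ennreal N"
    using nn_cond_exp_intg[of "\<lambda>_. 1" "\<lambda>y. ennreal (norm (f y) powr p)"]
    by (simp add: nnN G_def)
  have "(\<integral>\<^sup>+x. ennreal (enn2real (G x)) \<partial>M) = ennreal N"
    unfolding nnG[symmetric] by (rule nn_integral_cong_AE) (use finG in \<open>auto elim!: eventually_mono\<close>)
  then have Gint: "integrable M (\<lambda>x. enn2real (G x))" and GN: "(\<integral>x. enn2real (G x) \<partial>M) = N"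
    using nonneg by (auto intro!: integrableI_nonneg integral_eq_nn_integral simp: integral_eq_nn_integral)
  have H: "AE x in M. nn_cond_exp M F (\<lambda>x. ennreal (norm (u x * f x))) x
      \<le> ennreal (enn2real (w x) powr (1 / p') * enn2real (G x) powr (1 / p))"
    using nn_cond_exp_Hoelder[of "\<lambda>x. norm (u x)" "\<lambda>x. norm (f x)" p p'] fin finG exps p'
    by (simp add: w_def G_def norm_mult)
  have "AE x in M. nn_cond_exp M F (\<lambda>x. ennreal (norm (u x * f x))) x < \<infinity>"
    using H by eventually_elim (auto simp: le_less_trans)
  then show cond: "conditionable M F (\<lambda>x. u x * f x)"
    by (simp add: conditionable_def)
  \<comment> \<open>For \<open>N = 0\<close> the quotient \<open>G x / N\<close> in the bound below
    is 0 by convention; the bound survives because its left-hand side then vanishes almost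
    everywhere.\<close>
  have N0: "AE x in M. N = 0 \<longrightarrow> G x = 0"
    using nnG by (cases "N = 0") (auto simp: nn_integral_0_iff_AE)
  let ?d = "real DIM('k)"
  let ?B = "\<lambda>x. ?d powr q * (N powr (q / p) * (enn2real (w x) powr (r / p') + enn2real (G x) / N))"
  have bound: "AE x in M. norm (cond_op M F u f x) powr q \<le> ?B x"
    using norm_cond_expect_le[OF cond] H N0
  proof eventually_elim
    case (elim x)
    let ?h = "enn2real (w x) powr (1 / p') * enn2real (G x) powr (1 / p)"
    have "enn2real (nn_cond_exp M F (\<lambda>y. ennreal (norm (u y * f y))) x) \<le> ?h"
      using elim(2) by (auto intro: enn2real_leI)
    then have "norm (cond_op M F u f x) \<le> ?d * ?h"
      using elim(1) unfolding cond_op_def by (meson mult_left_mono of_nat_0_le_iff order_trans)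
    then have "norm (cond_op M F u f x) powr q \<le> (?d * ?h) powr q"
      using exps by (intro powr_mono2) auto
    also have "\<dots> = ?d powr q * ?h powr q" by (simp add: powr_mult)
    also have "?h powr q \<le> N powr (q / p) * (enn2real (w x) powr (r / p') + enn2real (G x) / N)"
    proof (cases "N = 0")
      case True
      then show ?thesis using elim(3) by simp
    next
      case False
      then show ?thesis using nonneg exps by (intro Young_scaled[of q p p' r]) auto
    qed
    finally show ?case by (simp add: mult_left_mono)
  qed
  have [measurable]: "cond_op M F u f \<in> borel_measurable M"
    unfolding cond_op_def by measurable
  have Bint: "integrable M ?B" using int Gint by auto
  have cint: "integrable M (\<lambda>x. norm (cond_op M F u f x) powr q)"
    by (rule Bochner_Integration.integrable_bound[OF Bint])
       (use bound in \<open>auto elim!: eventually_mono\<close>)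
  then show "cond_op M F u f \<in> Lp M q" by (simp add: Lp_def)
  have "(\<integral>x. norm (cond_op M F u f x) powr q \<partial>M) \<le> (\<integral>x. ?B x \<partial>M)"
    by (rule integral_mono_AE[OF cint Bint bound])
  also have "\<dots> = ?d powr q * (N powr (q / p) * (I + N / N))"
    using int Gint by (simp add: GN I_def)
  \<comment> \<open>\<open>N / N\<close> is 1, or 0 by convention if \<open>N = 0\<close>.\<close>
  also have "\<dots> \<le> ?d powr q * (N powr (q / p) * (I + 1))"
    by (intro mult_left_mono add_left_mono) auto
  finally have "(\<integral>x. norm (cond_op M F u f x) powr q \<partial>M) powr (1 / q)
      \<le> (?d powr q * (N powr (q / p) * (I + 1))) powr (1 / q)"
    using exps by (intro powr_mono2) auto
  also have "\<dots> = ?d * (I + 1) powr (1 / q) * N powr (1 / p)"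
    using exps nonneg by (simp add: powr_mult powr_powr)
  finally show "Lp_norm M q (cond_op M F u f)
      \<le> ?d * ((\<integral>x. enn2real (w x) powr (r / p') \<partial>M) + 1) powr (1 / q) * Lp_norm M p f"
    unfolding Lp_norm_def N_def I_def .
qed

section \<open>Necessity: test functions and exhaustion\<close>

text \<open>The components of \<open>of_real (g x)\<close> are the constant multiples
  \<open>g x * (1 \<bullet> b)\<close>, so linearity and the expansion of 1 in the basis reassemble
  the value. For the test function \<open>u * f\<close> is of this kind, which gives the norm of its
  conditional expectation exactly, without a dimension factor.\<close>

lemma cond_expect_of_real_AE:
  assumes "integrable M g"
  shows "AE x in M. cond_expect M F (\<lambda>x. of_real (g x) :: 'k::{real_normed_field, euclidean_space}) x
           = of_real (real_cond_exp M F g x)"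
proof -
  have "AE x in M. \<forall>b\<in>(Basis::'k set).
      real_cond_exp M F (\<lambda>x. g x * (1 \<bullet> b)) x = (1 \<bullet> b) * real_cond_exp M F g x"
    using assms by (auto simp: AE_finite_all mult.commute[of "g _"])
  then show ?thesis
  proof eventually_elim
    case (elim x)
    have "cond_expect M F (\<lambda>x. of_real (g x) :: 'k) x
        = (\<Sum>b\<in>Basis. real_cond_exp M F g x *\<^sub>R ((1 \<bullet> b) *\<^sub>R b))"
      unfolding cond_expect_of_real using elim by (intro sum.cong) (auto simp: mult.commute)
    also have "\<dots> = of_real (real_cond_exp M F g x)"
      unfolding scaleR_sum_right[symmetric] euclidean_representation of_real_def ..
    finally show ?case .
  qed
qed

text \<open>The bound depends neither on \<open>A\<close> nor on \<open>c\<close>, which is what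
  allows the cut-off to be removed later. For the test function, the norm inequality reads S^(1/q)
  <= K S^(1/p), where S is the integral to be bounded, and 1/q - 1/p = 1/r.\<close>

lemma truncated_moment_bound:
  fixes u :: "'a \<Rightarrow> 'k::{real_normed_field, euclidean_space}" and p p' q r K c :: real
    and \<phi> :: "'a \<Rightarrow> real"
  assumes exps: "1 < q" "q < p" "1 / p + 1 / p' = 1" "r = p * q / (p - q)"
    and u [measurable]: "u \<in> borel_measurable M"
    and K: "K \<ge> 0" "\<And>f. f \<in> Lp M p \<Longrightarrow> Lp_norm M q (cond_op M F u f) \<le> K * Lp_norm M p f"
    and A [measurable]: "A \<in> sets F" and Afin: "emeasure M A < \<infinity>"
    and \<phi>: "\<And>x. \<phi> x = (if x \<in> A \<and> norm (u x) \<le> c then norm (u x) powr p' else 0)"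
  shows "integrable M \<phi>"
    and "(\<integral>\<^sup>+x. ennreal (real_cond_exp M F \<phi> x powr (r / p')) \<partial>M) \<le> ennreal (K powr r)"
proof -
  have p': "p' > 1" using conjugate_exponent_gt_1[of p p'] exps by simp
  then have p'_eq: "p' = p / (p - 1)" using exps by (simp add: field_simps)
  have rpos: "r > 0" using exps by simp
  have [measurable]: "A \<in> sets M" using subalg A by (auto simp: subalgebra_def)
  have [measurable]: "\<phi> \<in> borel_measurable M" unfolding \<phi> by measurable
  define C where "C = \<bar>c\<bar> powr p'"
  have C: "\<phi> x \<le> C * indicator A x" "\<phi> x \<ge> 0" for x
    using p' by (auto simp: \<phi> C_def indicator_def intro!: powr_mono2)
  have intA: "integrable M (\<lambda>x. a * indicator A x)" for a :: real
    using Afin by (auto intro!: integrable_real_indicator)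
  show \<phi>int: "integrable M \<phi>"
    by (rule Bochner_Integration.integrable_bound[OF intA[of C]]) (use C in \<open>auto intro!: AE_I2 intro: order_trans[OF _ abs_ge_self]\<close>)
  \<comment> \<open>Within this proof \<open>w\<close> is the conditional expectation of the cut-off
    \<open>\<phi>\<close>, not of the full power of |u|.\<close>
  define w where "w = real_cond_exp M F \<phi>"
  have [measurable]: "w \<in> borel_measurable F" "w \<in> borel_measurable M" by (auto simp: w_def)
  have w0: "AE x in M. w x \<ge> 0"
    unfolding w_def by (rule real_cond_exp_pos) (use C in auto)
  \<comment> \<open>Since \<open>A\<close> lies in \<open>F\<close>, the dominating function
    \<open>C * indicator A x\<close> is its own conditional expectation. Hence \<open>w\<close>, and
    with it the weight \<open>k\<close>, is bounded.\<close>
  have "AE x in M. w x \<le> real_cond_exp M F (\<lambda>x. C * indicator A x) x"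
    unfolding w_def by (rule real_cond_exp_mono) (use C intA \<phi>int in auto)
  moreover have "AE x in M. real_cond_exp M F (\<lambda>x. C * indicator A x) x = C * indicator A x"
    by (rule real_cond_exp_F_meas) (use intA in auto)
  ultimately have wC: "AE x in M. w x \<le> C * indicator A x" by auto
  define k where "k x = w x powr ((q - 1) / (p - q))" for x
  have [measurable]: "k \<in> borel_measurable F" "k \<in> borel_measurable M"
    unfolding k_def by measurable
  have kC: "AE x in M. k x \<le> C powr ((q - 1) / (p - q))"
    using w0 wC
  proof eventually_elim
    case (elim x)
    have "w x \<le> C" using elim(2) order_trans[of "w x" 0 C] by (cases "x \<in> A") (simp_all add: C_def)
    then show ?case using elim exps by (auto simp: k_def intro!: powr_mono2)
  qed
  \<comment> \<open>Used with \<open>s = 1\<close> for \<open>u * f\<close> and with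
    \<open>s = p\<close> for |f|^p.\<close>
  have hint: "integrable M (\<lambda>x. k x powr s * \<phi> x)" if "s \<ge> 0" for s
  proof (rule Bochner_Integration.integrable_bound)
    show "integrable M (\<lambda>x. (C powr ((q - 1) / (p - q))) powr s * \<phi> x)" using \<phi>int by simp
    show "AE x in M. norm (k x powr s * \<phi> x) \<le> norm ((C powr ((q - 1) / (p - q))) powr s * \<phi> x)"
      using kC
    proof eventually_elim
      case (elim x)
      have "k x powr s \<le> (C powr ((q - 1) / (p - q))) powr s"
        using elim that by (intro powr_mono2) (auto simp: k_def)
      then show ?case using C(2)[of x] by (simp add: abs_mult mult_right_mono)
    qed
  qed measurable
  have k1: "k x powr 1 = k x" for x by (simp add: k_def)
  have kint: "integrable M (\<lambda>x. k x * \<phi> x)" using hint[of 1] unfolding k1 by simp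
  \<comment> \<open>Where \<open>u\<close> vanishes so does \<open>\<phi>\<close>, so the junk value \<open>f x = 0\<close> is the right one.\<close>
  define f :: "'a \<Rightarrow> 'k" where "f x = of_real (k x * \<phi> x) / u x" for x
  have [measurable]: "f \<in> borel_measurable M" unfolding f_def by measurable
  have uf: "u x * f x = of_real (k x * \<phi> x)" for x
    by (cases "u x = 0") (auto simp: f_def \<phi>)
  have nf: "norm (f x) powr p = k x powr p * \<phi> x" for x
  proof (cases "\<phi> x = 0")
    case False
    then have ph: "\<phi> x = norm (u x) powr p'" and un: "norm (u x) > 0"
      by (auto simp: \<phi> split: if_splits)
    have "norm (f x) = k x * norm (u x) powr (p' - 1)"
      using un by (simp add: f_def ph norm_divide norm_mult abs_mult k_def powr_diff)
    also have "\<dots> powr p = k x powr p * norm (u x) powr ((p' - 1) * p)"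
      by (simp add: powr_mult powr_powr)
    also have "(p' - 1) * p = p'" using exps unfolding p'_eq by (simp add: field_simps)
    finally show ?thesis by (simp add: ph)
  qed (use exps in \<open>simp add: f_def\<close>)
  have fLp: "f \<in> Lp M p" using hint[of p] exps by (simp add: Lp_def nf)
  define S where "S = (\<integral>x. w x powr (r / p') \<partial>M)"
  \<comment> \<open>Both exponents equal q(p-1)/(p-q); requiring them to agree is what determines
    the exponent of \<open>k\<close>.\<close>
  have e1: "(q - 1) / (p - q) * p + 1 = r / p'" "((q - 1) / (p - q) + 1) * q = r / p'"
    using exps unfolding exps(4) p'_eq by (simp_all add: field_simps)
  have eq1: "AE x in M. k x powr p * w x = w x powr (r / p')"
    using w0
  proof eventually_elim
    case (elim x)
    then show ?case
      using e1(1) by (cases "w x = 0") (auto simp: k_def powr_powr powr_add[of "w x" _ 1, simplified] simp flip: e1(1))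
  qed
  \<comment> \<open>The factor \<open>k x powr p\<close> is measurable with respect to
    \<open>F\<close>, so \<open>\<phi>\<close> may be replaced by its conditional expectation under
    the integral.\<close>
  have kw: "integrable M (\<lambda>x. k x powr p * w x)"
      "(\<integral>x. k x powr p * w x \<partial>M) = (\<integral>x. k x powr p * \<phi> x \<partial>M)"
    unfolding w_def using hint[of p] exps by (auto intro!: real_cond_exp_intg)
  have Sint: "integrable M (\<lambda>x. w x powr (r / p'))"
    using kw(1) eq1 by (subst integrable_cong_AE[of _ _ "\<lambda>x. k x powr p * w x"]) auto
  have S1: "(\<integral>x. norm (f x) powr p \<partial>M) = S"
    unfolding nf kw(2)[symmetric] S_def by (rule integral_cong_AE) (use eq1 in auto)
  have "AE x in M. cond_op M F u f x = of_real (real_cond_exp M F (\<lambda>x. k x * \<phi> x) x)"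
    unfolding cond_op_def uf by (rule cond_expect_of_real_AE[OF kint])
  moreover have "AE x in M. real_cond_exp M F (\<lambda>x. k x * \<phi> x) x = k x * w x"
    unfolding w_def by (rule real_cond_exp_mult) (use kint in auto)
  ultimately have eq2: "AE x in M. norm (cond_op M F u f x) powr q = w x powr (r / p')"
    using w0
  proof eventually_elim
    case (elim x)
    have "k x * w x = w x powr ((q - 1) / (p - q) + 1)"
      using elim(3) by (cases "w x = 0") (auto simp: k_def powr_add)
    then have "norm (cond_op M F u f x) = w x powr ((q - 1) / (p - q) + 1)"
      using elim by simp
    then show ?case by (simp only: powr_powr e1)
  qed
  have [measurable]: "cond_op M F u f \<in> borel_measurable M"
    unfolding cond_op_def by measurable
  have S2: "(\<integral>x. norm (cond_op M F u f x) powr q \<partial>M) = S"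
    unfolding S_def by (rule integral_cong_AE) (use eq2 in auto)
  have main: "S powr (1 / q) \<le> K * S powr (1 / p)"
    using K(2)[OF fLp] by (simp add: Lp_norm_def S1 S2)
  have S0: "S \<ge> 0" by (simp add: S_def)
  \<comment> \<open>The cut-off makes \<open>S\<close> finite, so for nonzero \<open>S\<close> the
    factor \<open>S powr (1 / p)\<close> can be divided out.\<close>
  have SK: "S \<le> K powr r"
  proof (cases "S = 0")
    case False
    with S0 have "S > 0" by simp
    have "S powr (1 / q - 1 / p) \<le> K"
      using main \<open>S > 0\<close> by (simp add: powr_diff field_simps)
    then have "(S powr (1 / q - 1 / p)) powr r \<le> K powr r"
      using rpos by (intro powr_mono2) auto
    moreover have "(1 / q - 1 / p) * r = 1" using exps by (simp add: field_simps)
    ultimately show ?thesis using \<open>S > 0\<close> by (simp add: powr_powr)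
  qed simp
  have "(\<integral>\<^sup>+x. ennreal (w x powr (r / p')) \<partial>M) = ennreal S"
    unfolding S_def by (rule nn_integral_eq_integral[OF Sint]) auto
  then show "(\<integral>\<^sup>+x. ennreal (real_cond_exp M F \<phi> x powr (r / p')) \<partial>M) \<le> ennreal (K powr r)"
    using SK by (simp add: w_def ennreal_leI)
qed

text \<open>The cut-offs increase to the full power of |u|, so their conditional expectations
  increase to \<open>w\<close> by conditional monotone convergence. The uniform bound on the
  integrals of their powers passes to the supremum, which yields both finiteness and
  integrability.\<close>

lemma norm_bounded_cond_opD:
  fixes u :: "'a \<Rightarrow> 'k::{real_normed_field, euclidean_space}" and p p' q r :: real
  defines "w \<equiv> nn_cond_exp M F (\<lambda>y. ennreal (norm (u y) powr p'))"
  assumes exps: "1 < q" "q < p" "1 / p + 1 / p' = 1" "r = p * q / (p - q)"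
    and u [measurable]: "u \<in> borel_measurable M"
    and bdd: "norm_bounded M p q (cond_op M F u)"
  shows "AE x in M. w x < \<infinity>" and "integrable M (\<lambda>x. enn2real (w x) powr (r / p'))"
proof -
  have p': "p' > 1" using conjugate_exponent_gt_1[of p p'] exps by simp
  define s where "s = r / p'"
  have s: "s > 0" using exps p' by (simp add: s_def)
  have [measurable]: "w \<in> borel_measurable M" by (auto simp: w_def)
  obtain K0 where K0: "\<And>f. f \<in> Lp M p \<Longrightarrow> Lp_norm M q (cond_op M F u f) \<le> K0 * Lp_norm M p f"
    using bdd by (auto simp: norm_bounded_def)
  \<comment> \<open>\<open>norm_bounded\<close> leaves the sign of its constant open, while the
    cut-off bound asks for a nonnegative one.\<close>
  define K where "K = \<bar>K0\<bar>"
  have K: "K \<ge> 0" "\<And>f. f \<in> Lp M p \<Longrightarrow> Lp_norm M q (cond_op M F u f) \<le> K * Lp_norm M p f"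
  proof -
    fix f :: "'a \<Rightarrow> 'k" assume "f \<in> Lp M p"
    then have "Lp_norm M q (cond_op M F u f) \<le> K0 * Lp_norm M p f" by (rule K0)
    also have "\<dots> \<le> K * Lp_norm M p f"
      by (intro mult_right_mono) (auto simp: K_def Lp_norm_def)
    finally show "Lp_norm M q (cond_op M F u f) \<le> K * Lp_norm M p f" .
  qed (simp add: K_def)
  \<comment> \<open>The exhausting sets have to belong to \<open>F\<close>, so they come from
    sigma-finiteness of the restricted measure.\<close>
  obtain A :: "nat \<Rightarrow> 'a set" where A: "range A \<subseteq> sets (restr_to_subalg M F)"
      "(\<Union>i. A i) = space (restr_to_subalg M F)"
      "\<And>i. emeasure (restr_to_subalg M F) (A i) \<noteq> \<infinity>" "incseq A"
    using sigma_finite_measure.sigma_finite_incseq[OF sigma_fin_subalg] by metis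
  have AF [measurable]: "A n \<in> sets F" for n using A(1) sets_restr_to_subalg[OF subalg] by auto
  then have [measurable]: "A n \<in> sets M" for n using subalg by (auto simp: subalgebra_def)
  have Afin: "emeasure M (A n) < \<infinity>" for n
    using A(3)[of n] emeasure_restr_to_subalg[OF subalg AF] by (simp add: top.not_eq_extremum)
  define \<phi> where "\<phi> n x = (if x \<in> A n \<and> norm (u x) \<le> real n then norm (u x) powr p' else 0)" for n x
  have [measurable]: "\<phi> n \<in> borel_measurable M" for n unfolding \<phi>_def by measurable
  note \<phi>b = truncated_moment_bound[OF exps u K AF Afin \<phi>_def]
  have inc: "incseq (\<lambda>n. ennreal (\<phi> n x))" for x
    using \<open>incseq A\<close> by (auto simp: incseq_def \<phi>_def intro!: ennreal_leI)
  have sup: "(SUP n. ennreal (\<phi> n x)) = ennreal (norm (u x) powr p')" if x: "x \<in> space M" for x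
  proof (rule antisym)
    show "(SUP n. ennreal (\<phi> n x)) \<le> ennreal (norm (u x) powr p')"
      by (intro SUP_least ennreal_leI) (simp add: \<phi>_def)
    obtain i where i: "x \<in> A i" using A(2) x by (auto simp: space_restr_to_subalg)
    obtain j where j: "norm (u x) \<le> real j" using real_arch_simple by blast
    have "x \<in> A (max i j)" using i \<open>incseq A\<close> by (meson incseqD max.cobounded1 subsetD)
    then have "\<phi> (max i j) x = norm (u x) powr p'" using j by (auto simp: \<phi>_def)
    then show "ennreal (norm (u x) powr p') \<le> (SUP n. ennreal (\<phi> n x))"
      by (metis SUP_upper UNIV_I)
  qed
  define v where "v n = real_cond_exp M F (\<phi> n)" for n
  have [measurable]: "v n \<in> borel_measurable M" for n by (simp add: v_def)
  have v0: "AE x in M. \<forall>n. v n x \<ge> 0"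
    unfolding AE_all_countable v_def by (intro allI real_cond_exp_pos) (auto simp: \<phi>_def)
  have veq: "AE x in M. \<forall>n. ennreal (v n x) = nn_cond_exp M F (\<lambda>x. ennreal (\<phi> n x)) x"
    unfolding AE_all_countable v_def
    by (intro allI ennreal_real_cond_exp \<phi>b(1)) (auto simp: \<phi>_def)
  have "AE x in M. w x = nn_cond_exp M F (\<lambda>x. SUP n. ennreal (\<phi> n x)) x"
    unfolding w_def by (rule nn_cond_exp_cong) (use sup in \<open>auto intro!: AE_I2\<close>)
  moreover have "AE x in M. nn_cond_exp M F (\<lambda>x. SUP n. ennreal (\<phi> n x)) x
      = (SUP n. nn_cond_exp M F (\<lambda>x. ennreal (\<phi> n x)) x)"
    and "AE x in M. incseq (\<lambda>n. nn_cond_exp M F (\<lambda>x. ennreal (\<phi> n x)) x)"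
    by (rule nn_cond_exp_SUP; use inc in simp)+
  ultimately have lim: "AE x in M. w x = (SUP n. ennreal (v n x)) \<and> incseq (\<lambda>n. v n x)"
    using veq v0
  proof eventually_elim
    case (elim x)
    have "v m x \<le> v n x" if "m \<le> n" for m n
    proof -
      have "ennreal (v m x) \<le> ennreal (v n x)" using elim that by (simp add: incseq_def)
      then show ?thesis using elim(5) by simp
    qed
    then show ?case using elim by (simp add: incseq_def)
  qed
  then have weq: "AE x in M. w x = (SUP n. ennreal (v n x))"
    and vinc: "AE x in M. incseq (\<lambda>n. v n x)"
    by simp_all
  let ?g = "\<lambda>x. SUP n. ennreal (v n x powr s)"
  have "(\<integral>\<^sup>+x. ?g x \<partial>M) = (SUP n. \<integral>\<^sup>+x. ennreal (v n x powr s) \<partial>M)"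
  proof (rule nn_integral_monotone_convergence_SUP_AE)
    show "AE x in M. ennreal (v i x powr s) \<le> ennreal (v (Suc i) x powr s)" for i
      using vinc v0
    proof eventually_elim
      case (elim x)
      then show ?case using s by (intro ennreal_leI powr_mono2) (auto simp: incseq_Suc_iff)
    qed
  qed measurable
  also have "\<dots> \<le> ennreal (K powr r)"
    using \<phi>b(2) by (intro SUP_least) (simp add: v_def s_def)
  finally have gfin: "(\<integral>\<^sup>+x. ?g x \<partial>M) < \<infinity>" by (simp add: le_less_trans)
  then have "AE x in M. ?g x \<noteq> \<infinity>" by (intro nn_integral_PInf_AE) auto
  \<comment> \<open>Because \<open>enn2real\<close> sends infinity to 0, finiteness of
    \<open>w\<close> must be settled first: a finite supremum \<open>a\<close> of the powers
    \<open>v n x powr s\<close> bounds every \<open>v n x\<close> by \<open>a powr (1 / s)\<close>.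
    Only then does continuity of the power identify the limit.\<close>
  then have fin: "AE x in M. w x < \<infinity> \<and> ennreal (enn2real (w x) powr s) \<le> ?g x"
    using weq vinc v0
  proof eventually_elim
    case (elim x)
    obtain a where a: "a \<ge> 0" "?g x = ennreal a" using elim(1) by (cases "?g x") auto
    have "v n x \<le> a powr (1 / s)" for n
    proof -
      have "v n x powr s \<le> a" using a by (metis SUP_upper UNIV_I ennreal_le_iff)
      then have "(v n x powr s) powr (1 / s) \<le> a powr (1 / s)"
        using s by (intro powr_mono2) auto
      then show ?thesis using s elim(4) by (simp add: powr_powr)
    qed
    then have "w x \<le> ennreal (a powr (1 / s))"
      unfolding elim(2) by (intro SUP_least ennreal_leI)
    then have wfin: "w x < \<infinity>" by (simp add: le_less_trans)
    then obtain b where b: "b \<ge> 0" "w x = ennreal b" by (cases "w x") auto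
    have "incseq (\<lambda>n. ennreal (v n x))" using elim(3) by (auto simp: incseq_def intro!: ennreal_leI)
    then have "(\<lambda>n. ennreal (v n x)) \<longlonglongrightarrow> ennreal b"
      using LIMSEQ_SUP[of "\<lambda>n. ennreal (v n x)"] elim(2) b by simp
    then have "(\<lambda>n. v n x) \<longlonglongrightarrow> b" using b elim(4) by (subst (asm) tendsto_ennreal_iff) auto
    then have "(\<lambda>n. v n x powr s) \<longlonglongrightarrow> b powr s"
      using s b elim(4) by (intro tendsto_powr2) auto
    then have "(\<lambda>n. ennreal (v n x powr s)) \<longlonglongrightarrow> ennreal (b powr s)" by (rule tendsto_ennrealI)
    then have "ennreal (b powr s) \<le> ?g x"
      by (rule LIMSEQ_le_const2) (auto intro!: exI SUP_upper)
    then show ?case using wfin b by simp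
  qed
  then show "AE x in M. w x < \<infinity>" by eventually_elim simp
  have "(\<integral>\<^sup>+x. ennreal (enn2real (w x) powr s) \<partial>M) \<le> (\<integral>\<^sup>+x. ?g x \<partial>M)"
    by (rule nn_integral_mono_AE) (use fin in \<open>auto elim!: eventually_mono\<close>)
  with gfin show "integrable M (\<lambda>x. enn2real (w x) powr (r / p'))"
    unfolding s_def[symmetric] by (intro integrableI_nonneg) auto
qed

section \<open>The equivalence for a general subalgebra\<close>

text \<open>The conditional expectation is measurable with respect to \<open>F\<close>, so its
  finiteness almost everywhere and its integrability mean the same for the restricted measure as for
  \<open>M\<close>; the powers \<open>1 / p'\<close> and \<open>r\<close> combine to
  \<open>r / p'\<close>.\<close>

lemma ennreal_powr_cond_exp_in_Lp_iff:
  fixes p' r :: real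
  assumes "p' > 0"
  shows "(\<lambda>x. ennreal_powr (nn_cond_exp M F g x) (1 / p')) \<in> ennreal_Lp (restr_to_subalg M F) r
    \<longleftrightarrow> (AE x in M. nn_cond_exp M F g x < \<infinity>) \<and>
        integrable M (\<lambda>x. enn2real (nn_cond_exp M F g x) powr (r / p'))"
proof -
  let ?w = "nn_cond_exp M F g" and ?R = "restr_to_subalg M F"
  have [measurable]: "?w \<in> borel_measurable ?R"
    by (intro measurable_in_subalg[OF subalg]) auto
  have "(AE x in ?R. ?w x < \<infinity>) \<longleftrightarrow> (AE x in M. ?w x < \<infinity>)"
    by (auto intro: AE_restr_to_subalg[OF subalg] intro!: AE_restr_to_subalg2[OF subalg])
  moreover have "integrable ?R (\<lambda>x. enn2real (?w x) powr (r / p'))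
      \<longleftrightarrow> integrable M (\<lambda>x. enn2real (?w x) powr (r / p'))"
    by (auto intro: integrable_from_subalg[OF subalg] intro!: integrable_in_subalg[OF subalg])
  ultimately show ?thesis
    by (simp add: ennreal_Lp_def Lp_def enn2real_ennreal_powr ennreal_powr_less_top_iff powr_powr)
qed

theorem cond_op_bounded_iff:
  fixes u :: "'a \<Rightarrow> 'k::{real_normed_field, euclidean_space}" and p p' q r :: real
  assumes exps: "1 < q" "q < p" "1 / p + 1 / p' = 1" "r = p * q / (p - q)"
    and u: "u \<in> borel_measurable M"
  shows "cond_op_bounded M F u p q \<longleftrightarrow>
    (\<lambda>x. ennreal_powr (nn_cond_exp M F (\<lambda>y. ennreal (norm (u y) powr p')) x) (1 / p'))
      \<in> ennreal_Lp (restr_to_subalg M F) r"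
proof -
  have "p' > 1" using conjugate_exponent_gt_1[of p p'] exps by simp
  moreover note ennreal_powr_cond_exp_in_Lp_iff
    [of p' "\<lambda>y. ennreal (norm (u y) powr p')" r]
  moreover have "norm_bounded M p q (cond_op M F u)" if "cond_op_bounded M F u p q"
    using that by (simp add: cond_op_bounded_def)
  ultimately show ?thesis
    using norm_bounded_cond_opD[OF exps u] cond_op_estimate[OF exps u]
    unfolding cond_op_bounded_def cond_op_well_defined_def norm_bounded_def
    by (auto intro!: exI)
qed

section \<open>The full sigma-algebra and multiplication operators\<close>

lemma nn_cond_exp_full:
  assumes "sets F = sets M" and "g \<in> borel_measurable M"
  shows "AE x in M. nn_cond_exp M F g x = g x"
  using nn_cond_exp_F_meas[of g] assms by (simp add: measurable_cong_sets[of F M] eq_commute)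

lemma conditionable_full:
  assumes "sets F = sets M" and [measurable]: "f \<in> borel_measurable M"
  shows "conditionable M F f"
  unfolding conditionable_def
  using nn_cond_exp_full[OF assms(1), of "\<lambda>y. ennreal (norm (f y))"] by (auto elim!: eventually_mono)

lemma cond_expect_full:
  fixes f :: "'a \<Rightarrow> 'k::{real_normed_field, euclidean_space}"
  assumes "sets F = sets M" and [measurable]: "f \<in> borel_measurable M"
  shows "AE x in M. cond_expect M F f x = f x"
proof -
  have "AE x in M. real_cond_exp M F (\<lambda>y. f y \<bullet> b) x = f x \<bullet> b" for b
  proof -
    have "AE x in M. nn_cond_exp M F (\<lambda>y. ennreal (f y \<bullet> b)) x = ennreal (f x \<bullet> b)"
      and "AE x in M. nn_cond_exp M F (\<lambda>y. ennreal (- (f y \<bullet> b))) x = ennreal (- (f x \<bullet> b))"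
      by (rule nn_cond_exp_full[OF assms(1)], measurable)+
    then show ?thesis
    proof eventually_elim
      case (elim x)
      then show ?case by (cases "f x \<bullet> b \<ge> 0") (simp_all add: real_cond_exp_def ennreal_neg)
    qed
  qed
  then have "AE x in M. \<forall>b\<in>Basis. real_cond_exp M F (\<lambda>y. f y \<bullet> (b::'k)) x = f x \<bullet> b"
    by (simp add: AE_finite_all)
  then show ?thesis
    by eventually_elim (simp add: cond_expect_def euclidean_representation)
qed

text \<open>The two operators agree only almost everywhere, which neither membership in
  \<open>Lp\<close> nor \<open>Lp_norm\<close> can detect; conditionability is automatic
  here.\<close>

lemma cond_op_bounded_full_iff:
  fixes u :: "'a \<Rightarrow> 'k::{real_normed_field, euclidean_space}"
  assumes F: "sets F = sets M" and [measurable]: "u \<in> borel_measurable M"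
  shows "cond_op_bounded M F u p q \<longleftrightarrow> mult_op_bounded M u p q"
proof -
  have m [measurable]: "cond_op M F u f \<in> borel_measurable M" for f
    unfolding cond_op_def by measurable
  have eq: "conditionable M F (\<lambda>x. u x * f x)"
      "cond_op M F u f \<in> Lp M q \<longleftrightarrow> mult_op u f \<in> Lp M q"
      "Lp_norm M q (cond_op M F u f) = Lp_norm M q (mult_op u f)" if "f \<in> Lp M p" for f
  proof -
    have [measurable]: "f \<in> borel_measurable M" using that by (simp add: Lp_def)
    then have [measurable]: "mult_op u f \<in> borel_measurable M" unfolding mult_op_def by measurable
    show "conditionable M F (\<lambda>x. u x * f x)" by (rule conditionable_full[OF F]) measurable
    have ae: "AE x in M. cond_op M F u f x = mult_op u f x"
      unfolding cond_op_def mult_op_def by (rule cond_expect_full[OF F]) measurable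
    then have ae': "AE x in M. norm (cond_op M F u f x) powr q = norm (mult_op u f x) powr q"
      by eventually_elim simp
    show "cond_op M F u f \<in> Lp M q \<longleftrightarrow> mult_op u f \<in> Lp M q"
      using integrable_cong_AE[OF _ _ ae'] by (simp add: Lp_def)
    show "Lp_norm M q (cond_op M F u f) = Lp_norm M q (mult_op u f)"
      using integral_cong_AE[OF _ _ ae'] by (simp add: Lp_norm_def)
  qed
  show ?thesis
    by (auto simp: cond_op_bounded_def mult_op_bounded_def cond_op_well_defined_def norm_bounded_def eq)
qed

lemma ennreal_powr_cond_exp_full_iff:
  fixes u :: "'a \<Rightarrow> 'k::{real_normed_field, euclidean_space}" and p' r :: real
  assumes F: "sets F = sets M" and [measurable]: "u \<in> borel_measurable M" and "p' > 0"
  shows "(\<lambda>x. ennreal_powr (nn_cond_exp M F (\<lambda>y. ennreal (norm (u y) powr p')) x) (1 / p'))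
      \<in> ennreal_Lp (restr_to_subalg M F) r \<longleftrightarrow> u \<in> Lp M r"
proof -
  let ?w = "nn_cond_exp M F (\<lambda>y. ennreal (norm (u y) powr p'))"
  have w: "AE x in M. ?w x = ennreal (norm (u x) powr p')"
    by (rule nn_cond_exp_full[OF F]) measurable
  then have "AE x in M. ?w x < \<infinity>" by eventually_elim simp
  moreover have "AE x in M. enn2real (?w x) powr (r / p') = norm (u x) powr r"
    using w by eventually_elim (use \<open>p' > 0\<close> in \<open>simp add: powr_powr\<close>)
  ultimately show ?thesis
    using integrable_cong_AE[of "\<lambda>x. enn2real (?w x) powr (r / p')" M "\<lambda>x. norm (u x) powr r"] \<open>p' > 0\<close>
    by (simp add: ennreal_powr_cond_exp_in_Lp_iff Lp_def)
qed

end

theorem mainTheorem5: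
  fixes M F :: "'a measure"
    and u :: "'a \<Rightarrow> 'k::{real_normed_field, euclidean_space}"
    and D :: "('a \<Rightarrow> 'k) set"
    and p p' q r :: real
  assumes "sigma_finite_measure M"
    and "sigma_finite_subalgebra M F"
    and "1 < q" and "q < p"
    and "1 / p + 1 / p' = 1"
    and "r = p * q / (p - q)"
    and "u \<in> borel_measurable M"
    and "linear_subspace_Lp M p D"
    and "cond_op_well_defined M F u q D"
  shows "(cond_op_bounded M F u p q \<longleftrightarrow>
           (\<lambda>x. ennreal_powr (nn_cond_exp M F (\<lambda>y. ennreal (norm (u y) powr p')) x) (1 / p'))
             \<in> ennreal_Lp (restr_to_subalg M F) r)
       \<and> (sets F = sets M \<longrightarrow>
           (\<forall>f :: 'a \<Rightarrow> 'k. f \<in> borel_measurable M \<longrightarrow>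
              conditionable M F f \<and> (AE x in M. cond_expect M F f x = f x)) \<and>
           (mult_op_bounded M u p q \<longleftrightarrow> u \<in> Lp M r))"
proof -
  interpret sigma_finite_subalgebra M F by fact
  have "p' > 1" using conjugate_exponent_gt_1[of p p'] assms by simp
  note iff = cond_op_bounded_iff[OF assms(3-7)]
  show ?thesis
    using iff assms(7) \<open>p' > 1\<close>
    by (auto simp: conditionable_full cond_expect_full
        cond_op_bounded_full_iff[symmetric] ennreal_powr_cond_exp_full_iff)
qed

end
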